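(* There is a universal constant $C\ge1$ (independent of the dimension) such that for every integer $d>1$ there is a closed convex set $\Omega\subseteq\mathbf{R}^d$ with $\mathcal{L}^d(\Omega)\ge1$ for which, for all $p\ge Cd$, $\mathrm{P}^p_\Omega$ fails to be nonexpansive with respect to the $p$-Wasserstein distance, i.e. there exist $\mu,\nu\in\mathcal{P}_p(\Omega)$ with $$W_p\big(\mathrm{P}^p_\Omega[\mu],\mathrm{P}^p_\Omega[\nu]\big)>W_p(\mu,\nu).$$
   Context: $\mathcal{L}^d$ is Lebesgue measure. For a closed convex set $\Omega\subseteq\mathbf{R}^d$ and $p\ge1$, $\mathcal{P}_p(\Omega)$ is the set of Borel probability measures supported in $\Omega$ with finite $p$-th moment, and $W_p$ is the $p$-Wasserstein distance for the cost $|x-y|^p$ with the Euclidean norm. Let $\mathcal{K}_p(\Omega)$ be the set of $\rho\in\mathcal{P}_p(\Omega)$ that are absolutely continuous with respect to Lebesgue measure with density satisfying $0\le\rho\le1$ a.e. For $p>1$ and $\mathcal{L}^d(\Omega)\ge1$, $\mathrm{P}^p_\Omega[\mu]$ denotes the metric projection of $\mu\in\mathcal{P}_p(\Omega)$ onto $\mathcal{K}_p(\Omega)$, i.e. the minimizer of $\rho\mapsto W_p^p(\rho,\mu)$ over $\rho\in\mathcal{K}_p(\Omega)$, which is known to exist and be unique. *)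

theory Defs
  imports "HOL-Probability.Probability"
begin

text \<open>
  The dimension \<open>d\<close> is quantified after the constant \<open>C\<close> in the theorem, so it cannot be a type.
  A point of \<open>\<real>\<^sup>d\<close> is a function in \<open>{..<d} \<rightarrow>\<^sub>E UNIV\<close> (equal to \<open>undefined\<close> outside
  \<open>{..<d}\<close>), which is the carrier both of the product measure \<open>PiM {..<d}\<close> and of the
  product topology over \<open>{..<d}\<close>.
\<close>

definition borel_Rd :: "nat \<Rightarrow> (nat \<Rightarrow> real) measure" where
  "borel_Rd d = (\<Pi>\<^sub>M i\<in>{..<d}. borel)"

definition lborel_Rd :: "nat \<Rightarrow> (nat \<Rightarrow> real) measure" where
  "lborel_Rd d = (\<Pi>\<^sub>M i\<in>{..<d}. lborel)"

definition norm_Rd :: "nat \<Rightarrow> (nat \<Rightarrow> real) \<Rightarrow> real" where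
  "norm_Rd d x = L2_set x {..<d}"

definition dist_Rd :: "nat \<Rightarrow> (nat \<Rightarrow> real) \<Rightarrow> (nat \<Rightarrow> real) \<Rightarrow> real" where
  "dist_Rd d x y = norm_Rd d (\<lambda>i. x i - y i)"

definition closed_Rd :: "nat \<Rightarrow> (nat \<Rightarrow> real) set \<Rightarrow> bool" where
  "closed_Rd d \<Omega> \<longleftrightarrow> closedin (product_topology (\<lambda>_. euclideanreal) {..<d}) \<Omega>"

definition convex_Rd :: "nat \<Rightarrow> (nat \<Rightarrow> real) set \<Rightarrow> bool" where
  "convex_Rd d \<Omega> \<longleftrightarrow> \<Omega> \<subseteq> ({..<d} \<rightarrow>\<^sub>E UNIV) \<and>
     (\<forall>x\<in>\<Omega>. \<forall>y\<in>\<Omega>. \<forall>u\<ge>0. \<forall>v\<ge>0. u + v = 1 \<longrightarrow> (\<lambda>i\<in>{..<d}. u * x i + v * y i) \<in> \<Omega>)"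

text \<open>Only used for closed \<open>\<Omega>\<close>, where full measure of \<open>\<Omega>\<close> says that the support lies in \<open>\<Omega>\<close>.\<close>

definition prob_measures :: "nat \<Rightarrow> real \<Rightarrow> (nat \<Rightarrow> real) set \<Rightarrow> (nat \<Rightarrow> real) measure set" where
  "prob_measures d p \<Omega> = {\<mu>. sets \<mu> = sets (borel_Rd d) \<and> prob_space \<mu> \<and>
     (AE x in \<mu>. x \<in> \<Omega>) \<and> (\<integral>\<^sup>+ x. ennreal (norm_Rd d x powr p) \<partial>\<mu>) < \<infinity>}"

definition couplings ::
  "nat \<Rightarrow> (nat \<Rightarrow> real) measure \<Rightarrow> (nat \<Rightarrow> real) measure \<Rightarrow> ((nat \<Rightarrow> real) \<times> (nat \<Rightarrow> real)) measure set" where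
  "couplings d \<mu> \<nu> = {\<gamma>. sets \<gamma> = sets (borel_Rd d \<Otimes>\<^sub>M borel_Rd d) \<and>
     distr \<gamma> (borel_Rd d) fst = \<mu> \<and> distr \<gamma> (borel_Rd d) snd = \<nu>}"

definition transport_cost ::
  "nat \<Rightarrow> real \<Rightarrow> (nat \<Rightarrow> real) measure \<Rightarrow> (nat \<Rightarrow> real) measure \<Rightarrow> ennreal" where
  "transport_cost d p \<mu> \<nu> =
     (INF \<gamma>\<in>couplings d \<mu> \<nu>. \<integral>\<^sup>+ z. ennreal (dist_Rd d (fst z) (snd z) powr p) \<partial>\<gamma>)"

text \<open>
  The cost is finite for measures with finite \<open>p\<close>-th moment, the only ones to which the distance
  is applied, so \<^const>\<open>enn2real\<close> (which sends \<open>\<infinity>\<close> to \<open>0\<close>) loses nothing.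
\<close>

definition wasserstein ::
  "nat \<Rightarrow> real \<Rightarrow> (nat \<Rightarrow> real) measure \<Rightarrow> (nat \<Rightarrow> real) measure \<Rightarrow> real" where
  "wasserstein d p \<mu> \<nu> = enn2real (transport_cost d p \<mu> \<nu>) powr (1 / p)"

definition bounded_density_measures ::
  "nat \<Rightarrow> real \<Rightarrow> (nat \<Rightarrow> real) set \<Rightarrow> (nat \<Rightarrow> real) measure set" where
  "bounded_density_measures d p \<Omega> = {\<rho> \<in> prob_measures d p \<Omega>.
     \<exists>f \<in> borel_measurable (lborel_Rd d).
       (AE x in lborel_Rd d. 0 \<le> f x \<and> f x \<le> (1::real)) \<and>
       \<rho> = density (lborel_Rd d) (\<lambda>x. ennreal (f x))}"

text \<open>
  The minimizer exists and is unique if \<open>p > 1\<close>, \<open>\<Omega>\<close> is closed and convex of Lebesgue measure at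
  least \<open>1\<close>, and \<open>\<mu> \<in> prob_measures d p \<Omega>\<close>.
\<close>

definition wasserstein_proj ::
  "nat \<Rightarrow> real \<Rightarrow> (nat \<Rightarrow> real) set \<Rightarrow> (nat \<Rightarrow> real) measure \<Rightarrow> (nat \<Rightarrow> real) measure" where
  "wasserstein_proj d p \<Omega> \<mu> =
     (THE \<rho>. is_arg_min (\<lambda>\<rho>. wasserstein d p \<rho> \<mu> powr p)
               (\<lambda>\<rho>. \<rho> \<in> bounded_density_measures d p \<Omega>) \<rho>)"

end

theory Submission
  imports Defs
begin

text \<open>
  The projection of a Dirac measure at \<open>x\<close> is uniform on the intersection of \<open>\<Omega>\<close> with the ball
  around \<open>x\<close> that cuts out volume 1 (bathtub principle). Let \<open>\<Omega>\<close> be a long thin wedge whose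
  cross-section grows linearly along the axis. When the centre of such a ball moves along the axis
  away from the tip, a slight advance of the wide end keeps the volume, so the narrow end
  recedes from the tip faster than the centre moves: centres 25 units apart produce projections
  such that a fixed fraction \<open>3 / 400\<close> of the mass of the first is at distance at least 29 from the
  second. Hence \<open>W\<^sub>p\<close> of the projections is at least \<open>29 * (3 / 400) powr (1 / p)\<close>, which exceeds 25
  for large \<open>p\<close>.
\<close>

section \<open>Euclidean geometry and measurability in coordinates\<close>

lemma space_borel_Rd [simp]: "space (borel_Rd d) = {..<d} \<rightarrow>\<^sub>E UNIV"
  by (simp add: borel_Rd_def space_PiM)

lemma sets_lborel_Rd [measurable_cong, simp]: "sets (lborel_Rd d) = sets (borel_Rd d)"
  unfolding lborel_Rd_def borel_Rd_def by (intro sets_PiM_cong) auto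

lemma space_lborel_Rd [simp]: "space (lborel_Rd d) = {..<d} \<rightarrow>\<^sub>E UNIV"
  by (simp add: lborel_Rd_def space_PiM)

lemma PiE_in_sets_borel_Rd [simp]: "{..<d} \<rightarrow>\<^sub>E UNIV \<in> sets (borel_Rd d)"
  using sets.top[of "borel_Rd d"] by simp

text \<open>Stated for every \<open>i\<close>, so that \<open>measurable\<close> can use it without
  a side condition: on the space, a coordinate outside \<open>{..<d}\<close> is the constant
  \<open>undefined\<close>.\<close>

lemma measurable_component_Rd [measurable]: "(\<lambda>x. x i) \<in> borel_measurable (borel_Rd d)"
proof (cases "i < d")
  case True
  then show ?thesis unfolding borel_Rd_def by simp
next
  case False
  then have "(\<lambda>x. x i) \<in> borel_measurable (borel_Rd d) \<longleftrightarrow>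
      (\<lambda>x. undefined :: real) \<in> borel_measurable (borel_Rd d)"
    by (intro measurable_cong) (auto simp: PiE_def extensional_def)
  then show ?thesis by simp
qed

lemma measurable_norm_Rd [measurable]: "norm_Rd d \<in> borel_measurable (borel_Rd d)"
  unfolding norm_Rd_def L2_set_def by measurable

lemma measurable_dist_Rd [measurable]:
  assumes [measurable]: "f \<in> M \<rightarrow>\<^sub>M borel_Rd d" "g \<in> M \<rightarrow>\<^sub>M borel_Rd d"
  shows "(\<lambda>x. dist_Rd d (f x) (g x)) \<in> borel_measurable M"
proof -
  have [measurable]: "(\<lambda>x. f x i) \<in> borel_measurable M" "(\<lambda>x. g x i) \<in> borel_measurable M" for i
    by (rule measurable_compose[OF _ measurable_component_Rd], fact)+
  show ?thesis unfolding dist_Rd_def norm_Rd_def L2_set_def by measurable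
qed

lemma measurable_dist_Rd_left [measurable]: "(\<lambda>z. dist_Rd d z x) \<in> borel_measurable (borel_Rd d)"
  unfolding dist_Rd_def norm_Rd_def L2_set_def by measurable

lemma dist_Rd_nonneg [simp]: "0 \<le> dist_Rd d x y"
  by (simp add: dist_Rd_def norm_Rd_def)

lemma norm_Rd_nonneg [simp]: "0 \<le> norm_Rd d x"
  by (simp add: norm_Rd_def)

lemma dist_Rd_le_norm: "dist_Rd d x y \<le> norm_Rd d x + norm_Rd d y"
proof -
  have "dist_Rd d x y = L2_set (\<lambda>i. x i + - y i) {..<d}"
    by (simp add: dist_Rd_def norm_Rd_def)
  also have "\<dots> \<le> L2_set x {..<d} + L2_set (\<lambda>i. - y i) {..<d}"
    by (rule L2_set_triangle_ineq)
  also have "L2_set (\<lambda>i. - y i) {..<d} = norm_Rd d y"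
    by (simp add: norm_Rd_def L2_set_def)
  finally show ?thesis by (simp add: norm_Rd_def)
qed

lemma dist_Rd_power2: "(dist_Rd d x y)\<^sup>2 = (\<Sum>i<d. (x i - y i)\<^sup>2)"
  by (simp add: dist_Rd_def norm_Rd_def L2_set_def sum_nonneg)

lemma abs_coord_le_dist_Rd: "i < d \<Longrightarrow> \<bar>x i - y i\<bar> \<le> dist_Rd d x y"
  using member_le_L2_set[of "{..<d}" i "\<lambda>i. \<bar>x i - y i\<bar>"]
  by (simp add: dist_Rd_def norm_Rd_def L2_set_def)

section \<open>Null spheres and balls of prescribed volume\<close>

text \<open>By Fubini in coordinate 0: a line in that direction meets a sphere in at most two
  points.\<close>

lemma sphere_null_Rd:
  assumes d: "d > 0"
  shows "AE z in lborel_Rd d. dist_Rd d z x \<noteq> r"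
proof -
  interpret product_sigma_finite "\<lambda>_::nat. lborel :: real measure" ..
  define S where "S = {z \<in> space (lborel_Rd d). dist_Rd d z x = r}"
  have S [measurable]: "S \<in> sets (lborel_Rd d)"
    unfolding S_def by measurable
  have D: "{..<d} = insert 0 {1..<d}" using d by auto
  have "emeasure (lborel_Rd d) S = (\<integral>\<^sup>+ z. indicator S z \<partial>lborel_Rd d)"
    using S by simp
  also have "\<dots> = (\<integral>\<^sup>+ z. (\<integral>\<^sup>+ y. indicator S (z(0 := y)) \<partial>lborel) \<partial>PiM {1..<d} (\<lambda>_. lborel))"
    using S unfolding lborel_Rd_def D by (subst product_nn_integral_insert) auto
  also have "\<dots> = (\<integral>\<^sup>+ z. 0 \<partial>PiM {1..<d} (\<lambda>_::nat. lborel :: real measure))"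
  proof (intro nn_integral_cong)
    fix z :: "nat \<Rightarrow> real"
    define c where "c = (\<Sum>i\<in>{1..<d}. (z i - x i)\<^sup>2)"
    \<comment> \<open>These are the solutions of the quadratic equation for \<open>y\<close>. If
      \<open>r^2 < c\<close> the line misses the sphere; \<open>T\<close> is still a finite superset
      of the empty section, hence null.\<close>
    define T where "T = {x 0 + sqrt (r\<^sup>2 - c), x 0 - sqrt (r\<^sup>2 - c)}"
    have "indicator S (z(0 := y)) \<le> (indicator T y :: ennreal)" for y
    proof (cases "z(0 := y) \<in> S")
      case True
      then have "r = dist_Rd d (z(0 := y)) x" by (simp add: S_def)
      then have "r\<^sup>2 = (\<Sum>i<d. ((z(0:=y)) i - x i)\<^sup>2)"
        by (simp only: dist_Rd_power2)
      also have "\<dots> = (y - x 0)\<^sup>2 + c"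
        unfolding D c_def by (subst sum.insert) (auto intro!: sum.cong)
      finally have "(y - x 0)\<^sup>2 = r\<^sup>2 - c" by simp
      then have "\<bar>y - x 0\<bar> = sqrt (r\<^sup>2 - c)" by (metis real_sqrt_abs)
      then have "y \<in> T" by (auto simp: T_def abs_if split: if_splits)
      then show ?thesis by (simp add: indicator_def)
    qed simp
    then have "(\<integral>\<^sup>+ y. indicator S (z(0 := y)) \<partial>lborel) \<le> (\<integral>\<^sup>+ y. indicator T y \<partial>lborel)"
      by (intro nn_integral_mono) auto
    also have "\<dots> = 0"
      by (simp add: T_def emeasure_lborel_countable)
    finally show "(\<integral>\<^sup>+ y. indicator S (z(0 := y)) \<partial>lborel) = 0" by simp
  qed
  finally have "emeasure (lborel_Rd d) S = 0" by simp
  with S show ?thesis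
    by (intro AE_I[of _ _ S]) (auto simp: S_def)
qed

text \<open>Intermediate value theorem for the volume as a function of the radius. That function is
  the distribution function of the distance to \<open>x\<close> under Lebesgue measure restricted to
  \<open>\<Omega>\<close>, and it is continuous because spheres are null.\<close>

lemma ex_radius_measure_eq:
  assumes d: "d > 0" and \<Omega> [measurable]: "\<Omega> \<in> sets (borel_Rd d)"
    and fin: "emeasure (lborel_Rd d) \<Omega> < \<infinity>"
    and "a \<le> b" and a: "emeasure (lborel_Rd d) {z\<in>\<Omega>. dist_Rd d z x \<le> a} \<le> ennreal v"
    and b: "ennreal v \<le> emeasure (lborel_Rd d) {z\<in>\<Omega>. dist_Rd d z x \<le> b}" and v: "0 \<le> v"
  shows "\<exists>r. a \<le> r \<and> r \<le> b \<and> emeasure (lborel_Rd d) {z\<in>\<Omega>. dist_Rd d z x \<le> r} = ennreal v"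
proof -
  let ?L = "lborel_Rd d"
  define M where "M = density ?L (indicator \<Omega>)"
  define N where "N = distr M borel (\<lambda>z. dist_Rd d z x)"
  have sub: "\<Omega> \<subseteq> {..<d} \<rightarrow>\<^sub>E UNIV" using sets.sets_into_space[OF \<Omega>] by simp
  have N: "emeasure N B = emeasure ?L {z\<in>\<Omega>. dist_Rd d z x \<in> B}" if [measurable]: "B \<in> sets borel" for B
  proof -
    have "emeasure N B = emeasure M ((\<lambda>z. dist_Rd d z x) -` B \<inter> space ?L)"
      unfolding N_def M_def by (subst emeasure_distr) auto
    also have "\<dots> = emeasure ?L (\<Omega> \<inter> ((\<lambda>z. dist_Rd d z x) -` B \<inter> space ?L))"
    proof -
      have "(\<lambda>z. dist_Rd d z x) -` B \<inter> space (borel_Rd d) \<in> sets (borel_Rd d)"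
        by (rule measurable_sets) measurable
      then show ?thesis unfolding M_def by (subst emeasure_restricted) auto
    qed
    also have "\<Omega> \<inter> ((\<lambda>z. dist_Rd d z x) -` B \<inter> space ?L) = {z\<in>\<Omega>. dist_Rd d z x \<in> B}"
      using sub by auto
    finally show ?thesis .
  qed
  have "emeasure N (space N) \<noteq> \<infinity>"
    using N[of UNIV] fin by (simp add: N_def)
  then interpret N: finite_measure N by (rule finite_measureI)
  interpret N: finite_borel_measure N
    by unfold_locales (simp add: N_def)
  have cdf: "ennreal (cdf N r) = emeasure ?L {z\<in>\<Omega>. dist_Rd d z x \<le> r}" for r
    using N[of "{..r}"] by (simp add: cdf_def N.emeasure_eq_measure)
  have "isCont (cdf N) r" for r
  proof -
    have "emeasure ?L {z \<in> space ?L. z \<in> \<Omega> \<and> dist_Rd d z x = r} = 0"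
      using sphere_null_Rd[OF d, of x r] by (intro emeasure_eq_0_AE) auto
    moreover have "{z \<in> space ?L. z \<in> \<Omega> \<and> dist_Rd d z x = r} = {z\<in>\<Omega>. dist_Rd d z x \<in> {r}}"
      using sub by auto
    ultimately have "emeasure ?L {z\<in>\<Omega>. dist_Rd d z x \<in> {r}} = 0" by simp
    then have "emeasure N {r} = 0" using N[of "{r}"] by simp
    then show ?thesis by (simp add: N.isCont_cdf measure_def)
  qed
  moreover have "cdf N a \<le> v" "v \<le> cdf N b"
    using a b v by (simp_all add: cdf[symmetric] N.cdf_nonneg)
  ultimately obtain r where "a \<le> r" "r \<le> b" "cdf N r = v"
    using IVT[of "cdf N" a v b] \<open>a \<le> b\<close> by auto
  then show ?thesis using cdf[of r] by auto
qed

section \<open>Transport costs\<close>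

text \<open>Under any coupling with a Dirac measure the second component is almost surely at
  distance 0 from \<open>x\<close>. All couplings therefore have the same cost.\<close>

lemma transport_cost_dirac:
  assumes "prob_space \<rho>" and sets [measurable_cong, simp]: "sets \<rho> = sets (borel_Rd d)"
    and x: "x \<in> space (borel_Rd d)"
  shows "transport_cost d p \<rho> (return (borel_Rd d) x) = (\<integral>\<^sup>+ z. ennreal (dist_Rd d z x powr p) \<partial>\<rho>)"
proof -
  let ?B = "borel_Rd d"
  let ?I = "\<integral>\<^sup>+ z. ennreal (dist_Rd d z x powr p) \<partial>\<rho>"
  interpret prob_space \<rho> by fact
  have const: "(\<integral>\<^sup>+ z. ennreal (dist_Rd d (fst z) (snd z) powr p) \<partial>\<gamma>) = ?I"
    if "\<gamma> \<in> couplings d \<rho> (return ?B x)" for \<gamma>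
  proof -
    from that have sets_\<gamma> [measurable_cong, simp]: "sets \<gamma> = sets (?B \<Otimes>\<^sub>M ?B)"
      and fst: "distr \<gamma> ?B fst = \<rho>" and snd: "distr \<gamma> ?B snd = return ?B x"
      by (auto simp: couplings_def)
    \<comment> \<open>Being equal to \<open>x\<close> is replaced by being at distance 0 from it, an
      event whose measurability is immediate.\<close>
    have pred: "Measurable.pred ?B (\<lambda>y. dist_Rd d y x = 0)" by measurable
    have "AE y in return ?B x. dist_Rd d y x = 0"
      using x pred by (subst AE_return) (auto simp: dist_Rd_def norm_Rd_def L2_set_def)
    then have "AE z in \<gamma>. dist_Rd d (snd z) x = 0"
      unfolding snd[symmetric] using pred by (subst (asm) AE_distr_iff) (auto simp: pred_def)
    then have "AE z in \<gamma>. ennreal (dist_Rd d (fst z) (snd z) powr p) = ennreal (dist_Rd d (fst z) x powr p)"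
    proof (rule eventually_mono)
      fix z :: "(nat \<Rightarrow> real) \<times> (nat \<Rightarrow> real)"
      assume "dist_Rd d (snd z) x = 0"
      then have "\<bar>snd z i - x i\<bar> \<le> 0" if "i < d" for i
        using abs_coord_le_dist_Rd[OF that, of "snd z" x] by simp
      then have "dist_Rd d (fst z) (snd z) = dist_Rd d (fst z) x"
        unfolding dist_Rd_def norm_Rd_def by (intro L2_set_cong) auto
      then show "ennreal (dist_Rd d (fst z) (snd z) powr p) = ennreal (dist_Rd d (fst z) x powr p)"
        by simp
    qed
    then have "(\<integral>\<^sup>+ z. ennreal (dist_Rd d (fst z) (snd z) powr p) \<partial>\<gamma>)
        = (\<integral>\<^sup>+ z. ennreal (dist_Rd d (fst z) x powr p) \<partial>\<gamma>)"
      by (rule nn_integral_cong_AE)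
    also have "\<dots> = (\<integral>\<^sup>+ z. ennreal (dist_Rd d z x powr p) \<partial>distr \<gamma> ?B fst)"
      by (subst nn_integral_distr) auto
    finally show ?thesis by (simp add: fst)
  qed
  \<comment> \<open>This coupling shows that the infimum is not over the empty set, where it would
    be \<infinity>.\<close>
  have "distr \<rho> (?B \<Otimes>\<^sub>M ?B) (\<lambda>z. (z, x)) \<in> couplings d \<rho> (return ?B x)"
    using x distr_const[OF x]
    by (auto simp: couplings_def distr_distr comp_def distr_id2)
  then show ?thesis
    unfolding transport_cost_def using const by (intro INF_eqI) auto
qed

text \<open>The target lives on \<open>B\<close>, so each coupling moves all the mass that starts in
  \<open>A\<close> by at least \<open>g\<close>.\<close>

lemma transport_cost_ge_gap:
  assumes [measurable_cong, simp]: "sets \<rho>0 = sets (borel_Rd d)" "sets \<rho>1 = sets (borel_Rd d)"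
    and A [measurable]: "A \<in> sets (borel_Rd d)" and B [measurable]: "B \<in> sets (borel_Rd d)"
    and ae: "AE y in \<rho>1. y \<in> B"
    and gap: "\<And>x y. x \<in> A \<Longrightarrow> y \<in> B \<Longrightarrow> g \<le> dist_Rd d x y" and "0 \<le> g" "0 \<le> p"
  shows "ennreal (g powr p) * emeasure \<rho>0 A \<le> transport_cost d p \<rho>0 \<rho>1"
  unfolding transport_cost_def
proof (rule INF_greatest)
  let ?B = "borel_Rd d"
  fix \<gamma> assume "\<gamma> \<in> couplings d \<rho>0 \<rho>1"
  then have sets_\<gamma> [measurable_cong, simp]: "sets \<gamma> = sets (?B \<Otimes>\<^sub>M ?B)"
    and fst: "distr \<gamma> ?B fst = \<rho>0" and snd: "distr \<gamma> ?B snd = \<rho>1"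
    by (auto simp: couplings_def)
  have "{y \<in> space ?B. y \<in> B} \<in> sets ?B" by measurable
  with ae have ae': "AE z in \<gamma>. snd z \<in> B"
    unfolding snd[symmetric] by (subst (asm) AE_distr_iff) auto
  have "emeasure \<rho>0 A = (\<integral>\<^sup>+ x. indicator A x \<partial>\<rho>0)" by simp
  also have "\<dots> = (\<integral>\<^sup>+ z. indicator A (fst z) \<partial>\<gamma>)"
    unfolding fst[symmetric] by (subst nn_integral_distr) auto
  finally have "ennreal (g powr p) * emeasure \<rho>0 A = (\<integral>\<^sup>+ z. ennreal (g powr p) * indicator A (fst z) \<partial>\<gamma>)"
    by (subst nn_integral_cmult) auto
  also have "\<dots> \<le> (\<integral>\<^sup>+ z. ennreal (dist_Rd d (fst z) (snd z) powr p) \<partial>\<gamma>)"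
    using ae' by (intro nn_integral_mono_AE, elim eventually_mono)
      (use gap \<open>0 \<le> g\<close> \<open>0 \<le> p\<close> in \<open>auto intro!: ennreal_leI powr_mono2 split: split_indicator\<close>)
  finally show "ennreal (g powr p) * emeasure \<rho>0 A
      \<le> (\<integral>\<^sup>+ z. ennreal (dist_Rd d (fst z) (snd z) powr p) \<partial>\<gamma>)" .
qed

text \<open>The product coupling has cost at most \<open>(2 * D) powr p\<close>. Finiteness matters
  because \<open>enn2real\<close> in \<open>wasserstein\<close> would turn an infinite cost into 0,
  and a lower bound for the cost would then say nothing about the distance.\<close>

lemma transport_cost_finite:
  assumes "prob_space \<rho>0" "prob_space \<rho>1"
    and [measurable_cong, simp]: "sets \<rho>0 = sets (borel_Rd d)" "sets \<rho>1 = sets (borel_Rd d)"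
    and ae: "AE x in \<rho>0. norm_Rd d x \<le> D" "AE x in \<rho>1. norm_Rd d x \<le> D" and "0 \<le> p"
  shows "transport_cost d p \<rho>0 \<rho>1 < \<infinity>"
proof -
  let ?B = "borel_Rd d"
  interpret r0: prob_space \<rho>0 by fact
  interpret r1: prob_space \<rho>1 by fact
  interpret pair_prob_space \<rho>0 \<rho>1 ..
  let ?\<gamma> = "\<rho>0 \<Otimes>\<^sub>M \<rho>1"
  have sets_\<gamma> [measurable_cong, simp]: "sets ?\<gamma> = sets (?B \<Otimes>\<^sub>M ?B)"
    by (rule sets_pair_measure_cong) auto
  have fst: "distr ?\<gamma> ?B fst = \<rho>0"
    using r1.distr_pair_fst[of \<rho>0] distr_cong[of ?\<gamma> ?\<gamma> ?B \<rho>0 fst fst] by simp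
  have snd: "distr ?\<gamma> ?B snd = \<rho>1"
  proof (rule measure_eqI)
    fix A assume "A \<in> sets (distr ?\<gamma> ?B snd)"
    then have A: "A \<in> sets \<rho>1" by simp
    then have "A \<subseteq> space \<rho>1" by (rule sets.sets_into_space)
    with A have "emeasure (distr ?\<gamma> ?B snd) A = emeasure ?\<gamma> (space \<rho>0 \<times> A)"
      by (subst emeasure_distr)
        (auto simp: space_pair_measure intro!: arg_cong2[where f=emeasure])
    also have "\<dots> = emeasure \<rho>0 (space \<rho>0) * emeasure \<rho>1 A"
      by (rule r1.emeasure_pair_measure_Times[OF sets.top A])
    finally show "emeasure (distr ?\<gamma> ?B snd) A = emeasure \<rho>1 A"
      by (simp only: r0.emeasure_space_1 mult_1)
  qed simp
  have pred: "{y \<in> space ?B. norm_Rd d y \<le> D} \<in> sets ?B" by measurable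
  have "AE z in ?\<gamma>. norm_Rd d (fst z) \<le> D"
    using AE_distr_iff[of fst ?\<gamma> ?B, OF _ pred] ae(1) unfolding fst by simp
  moreover have "AE z in ?\<gamma>. norm_Rd d (snd z) \<le> D"
    using AE_distr_iff[of snd ?\<gamma> ?B, OF _ pred] ae(2) unfolding snd by simp
  ultimately have "AE z in ?\<gamma>. dist_Rd d (fst z) (snd z) \<le> 2 * D"
  proof eventually_elim
    case (elim z)
    then show ?case using dist_Rd_le_norm[of d "fst z" "snd z"] by linarith
  qed
  then have "(\<integral>\<^sup>+ z. ennreal (dist_Rd d (fst z) (snd z) powr p) \<partial>?\<gamma>)
      \<le> (\<integral>\<^sup>+ z. ennreal ((2 * D) powr p) \<partial>?\<gamma>)"
    using \<open>0 \<le> p\<close> by (intro nn_integral_mono_AE, elim eventually_mono) (auto intro!: ennreal_leI powr_mono2)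
  also have "\<dots> < \<infinity>"
    by (simp add: emeasure_space_1)
  finally have "(\<integral>\<^sup>+ z. ennreal (dist_Rd d (fst z) (snd z) powr p) \<partial>?\<gamma>) < \<infinity>" .
  moreover have "?\<gamma> \<in> couplings d \<rho>0 \<rho>1"
    by (simp add: couplings_def fst snd)
  ultimately show ?thesis
    unfolding transport_cost_def by (meson INF_lower le_less_trans)
qed

section \<open>Projections of Dirac measures\<close>

lemma dirac_prob_measures:
  assumes x: "x \<in> \<Omega>" and \<Omega>: "\<Omega> \<in> sets (borel_Rd d)"
  shows "return (borel_Rd d) x \<in> prob_measures d p \<Omega>"
proof -
  have x': "x \<in> space (borel_Rd d)" using sets.sets_into_space[OF \<Omega>] x by auto
  have "Measurable.pred (borel_Rd d) (\<lambda>x. x \<in> \<Omega>)" using \<Omega> by measurable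
  then show ?thesis
    unfolding prob_measures_def using x x'
    by (auto simp: prob_space_return AE_return nn_integral_return)
qed

lemma uniform_bounded_density_measures:
  assumes A [measurable]: "A \<in> sets (borel_Rd d)" and sub: "A \<subseteq> \<Omega>"
    and vol: "emeasure (lborel_Rd d) A = 1"
    and bnd: "\<And>z. z \<in> \<Omega> \<Longrightarrow> norm_Rd d z \<le> D" and p: "0 \<le> p"
  shows "density (lborel_Rd d) (indicator A) \<in> bounded_density_measures d p \<Omega>"
proof -
  let ?L = "lborel_Rd d" and ?\<rho> = "density (lborel_Rd d) (indicator A)"
  have A': "A \<in> sets ?L" by simp
  have prob: "prob_space ?\<rho>"
    using emeasure_restricted[OF A' sets.top] vol sets.sets_into_space[OF A']
    by (intro prob_spaceI) (simp add: Int_absorb2)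
  have inA: "AE z in ?\<rho>. z \<in> A"
    by (subst AE_density) (auto split: split_indicator)
  interpret prob_space ?\<rho> by fact
  have "(\<integral>\<^sup>+ z. ennreal (norm_Rd d z powr p) \<partial>?\<rho>) \<le> (\<integral>\<^sup>+ z. ennreal (D powr p) \<partial>?\<rho>)"
    using inA by (intro nn_integral_mono_AE, elim eventually_mono)
      (use sub p in \<open>auto intro!: ennreal_leI powr_mono2 bnd\<close>)
  also have "\<dots> < \<infinity>" using emeasure_space_1 by (simp add: ennreal_mult_less_top)
  finally have "?\<rho> \<in> prob_measures d p \<Omega>"
    using prob inA sub by (auto simp: prob_measures_def elim: eventually_mono)
  \<comment> \<open>\<open>bounded_density_measures\<close> asks for a real-valued density, whereas
    the indicator in \<open>?\<rho>\<close> is \<open>ennreal\<close>-valued.\<close>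
  moreover have "?\<rho> = density ?L (\<lambda>z. ennreal (indicator A z))"
    by (intro density_cong) (auto split: split_indicator)
  ultimately show ?thesis
    unfolding bounded_density_measures_def
    by (auto intro!: bexI[of _ "indicator A"] split: split_indicator)
qed

text \<open>
  Bathtub principle: if \<open>0 \<le> f \<le> 1\<close> has the same mass as the ball \<open>A\<close> and \<open>\<phi>\<close> is the cost, then
  \<open>(f - indicator A) (\<phi> - r powr p) \<ge> 0\<close>; spheres are null, so this vanishes a.e. only for
  \<open>f = indicator A\<close>.
\<close>

lemma cost_dirac_ball_minimal:
  assumes d: "d > 0" and \<Omega> [measurable]: "\<Omega> \<in> sets (borel_Rd d)"
    and bnd: "\<And>z. z \<in> \<Omega> \<Longrightarrow> norm_Rd d z \<le> D" and x: "x \<in> space (borel_Rd d)"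
    and p: "0 < p" and r: "0 \<le> r"
    and vol: "emeasure (lborel_Rd d) {z\<in>\<Omega>. dist_Rd d z x \<le> r} = 1"
    and \<rho>: "\<rho> \<in> bounded_density_measures d p \<Omega>"
  defines "\<rho>0 \<equiv> density (lborel_Rd d) (indicator {z\<in>\<Omega>. dist_Rd d z x \<le> r})"
  defines "\<phi> \<equiv> \<lambda>z. dist_Rd d z x powr p"
  shows "integral\<^sup>L \<rho>0 \<phi> \<le> integral\<^sup>L \<rho> \<phi>"
    and "integral\<^sup>L \<rho> \<phi> \<le> integral\<^sup>L \<rho>0 \<phi> \<Longrightarrow> \<rho> = \<rho>0"
proof -
  let ?L = "lborel_Rd d"
  define A where "A = {z\<in>\<Omega>. dist_Rd d z x \<le> r}"
  have sub: "\<Omega> \<subseteq> {..<d} \<rightarrow>\<^sub>E UNIV" using sets.sets_into_space[OF \<Omega>] by simp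
  have "A = {z \<in> space (borel_Rd d). z \<in> \<Omega> \<and> dist_Rd d z x \<le> r}"
    using sub by (auto simp: A_def)
  also have "\<dots> \<in> sets (borel_Rd d)" by measurable
  finally have A [measurable]: "A \<in> sets (borel_Rd d)" .
  define c where "c = r powr p"
  define K where "K = (D + norm_Rd d x) powr p"
  have [measurable]: "\<phi> \<in> borel_measurable (borel_Rd d)"
    unfolding \<phi>_def by measurable
  have \<phi>0: "0 \<le> \<phi> z" for z by (simp add: \<phi>_def)
  have \<phi>K: "\<phi> z \<le> K" if "z \<in> \<Omega>" for z
    unfolding \<phi>_def K_def using dist_Rd_le_norm[of d z x] bnd[OF that] p by (intro powr_mono2) auto
  have less_c: "\<phi> z < c" if "dist_Rd d z x < r" for z
    unfolding \<phi>_def c_def using that p by (intro powr_less_mono2) auto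
  have gr_c: "\<phi> z > c" if "dist_Rd d z x > r" for z
    unfolding \<phi>_def c_def using that p r by (intro powr_less_mono2) auto

  obtain f where f [measurable]: "f \<in> borel_measurable ?L"
    and f01: "AE z in ?L. 0 \<le> f z \<and> f z \<le> (1::real)"
    and \<rho>_eq: "\<rho> = density ?L (\<lambda>z. ennreal (f z))"
    and "\<rho> \<in> prob_measures d p \<Omega>"
    using \<rho> by (auto simp: bounded_density_measures_def)
  then have prob: "prob_space \<rho>" and "AE z in \<rho>. z \<in> \<Omega>"
    by (auto simp: prob_measures_def)
  interpret prob_space \<rho> by fact
  \<comment> \<open>The ball may leave \<open>\<Omega>\<close>, and there the cost is below
    \<open>c\<close>, so a positive \<open>f\<close> would spoil the sign of \<open>g\<close>. The
    support condition on \<open>\<rho>\<close> excludes this.\<close>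
  have f\<Omega>: "AE z in ?L. z \<notin> \<Omega> \<longrightarrow> f z = 0"
  proof -
    have "AE z in ?L. 0 < ennreal (f z) \<longrightarrow> z \<in> \<Omega>"
      using \<open>AE z in \<rho>. z \<in> \<Omega>\<close> unfolding \<rho>_eq by (subst (asm) AE_density) auto
    with f01 show ?thesis by eventually_elim auto
  qed
  have "(\<integral>\<^sup>+ z. ennreal (f z) \<partial>?L) = emeasure \<rho> (space \<rho>)"
    unfolding \<rho>_eq by (subst emeasure_density) (auto intro!: nn_integral_cong split: split_indicator)
  then have nn_f: "(\<integral>\<^sup>+ z. ennreal (f z) \<partial>?L) = 1" by (simp add: emeasure_space_1)
  have f0: "AE z in ?L. 0 \<le> f z" using f01 by eventually_elim simp
  have int_f: "integrable ?L f"
    using nn_f f0 by (intro integrableI_nonneg) auto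
  have I_f: "integral\<^sup>L ?L f = 1"
    using nn_f f0 by (subst integral_eq_nn_integral) auto
  have A_vol: "emeasure ?L A = 1" using vol by (simp add: A_def)
  have int_A: "integrable ?L (indicator A :: _ \<Rightarrow> real)"
    using A_vol by (intro integrable_real_indicator) auto
  have I_A: "integral\<^sup>L ?L (indicator A :: _ \<Rightarrow> real) = 1"
    using A_vol sets.sets_into_space[OF A] by (simp add: measure_def Int_absorb2)
  have int_f\<phi>: "integrable ?L (\<lambda>z. f z * \<phi> z)"
  proof (rule Bochner_Integration.integrable_bound)
    show "integrable ?L (\<lambda>z. K * f z)" using int_f by simp
    show "AE z in ?L. norm (f z * \<phi> z) \<le> norm (K * f z)"
      using f0 f\<Omega>
    proof eventually_elim
      case (elim z)
      then show ?case using \<phi>0[of z] \<phi>K[of z]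
        by (cases "z \<in> \<Omega>") (auto simp: abs_mult mult.commute[of K] intro: mult_left_mono)
    qed
  qed measurable
  have int_A\<phi>: "integrable ?L (\<lambda>z. indicator A z * \<phi> z)"
  proof (rule Bochner_Integration.integrable_bound)
    show "integrable ?L (\<lambda>z. K * indicator A z :: real)" using int_A by simp
    show "AE z in ?L. norm (indicator A z * \<phi> z) \<le> norm (K * indicator A z :: real)"
      using \<phi>0 order_trans[OF \<phi>K abs_ge_self] by (intro AE_I2) (auto simp: A_def abs_mult split: split_indicator)
  qed measurable
  have \<rho>_int: "integral\<^sup>L \<rho> \<phi> = (\<integral>z. f z * \<phi> z \<partial>?L)"
    unfolding \<rho>_eq using f0 by (subst integral_density) auto
  have \<rho>0_eq: "\<rho>0 = density ?L (\<lambda>z. ennreal (indicator A z))"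
    unfolding \<rho>0_def A_def[symmetric] by (intro density_cong) (auto split: split_indicator)
  have \<rho>0_int: "integral\<^sup>L \<rho>0 \<phi> = (\<integral>z. indicator A z * \<phi> z \<partial>?L)"
    unfolding \<rho>0_eq by (subst integral_density) auto

  define g where "g = (\<lambda>z. (f z - indicator A z) * (\<phi> z - c))"
  have g_eq: "g = (\<lambda>z. f z * \<phi> z - indicator A z * \<phi> z - (c * f z - c * indicator A z))"
    by (auto simp: g_def algebra_simps)
  have int_g: "integrable ?L g"
    unfolding g_eq using int_f int_A int_f\<phi> int_A\<phi> by auto
  \<comment> \<open>Both \<open>f\<close> and the indicator of \<open>A\<close> have integral 1, so
    the terms with \<open>c\<close> cancel and the difference of the costs remains.\<close>
  have I_g: "integral\<^sup>L ?L g = integral\<^sup>L \<rho> \<phi> - integral\<^sup>L \<rho>0 \<phi>"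
    unfolding g_eq using int_f int_A int_f\<phi> int_A\<phi> I_A by (simp add: I_f \<rho>_int \<rho>0_int)
  have sphere: "AE z in ?L. dist_Rd d z x \<noteq> r" by (rule sphere_null_Rd[OF d])
  have g0: "AE z in ?L. 0 \<le> g z"
    using f01 f\<Omega> sphere
  proof eventually_elim
    case (elim z)
    consider "z \<in> A" | "z \<in> \<Omega>" "z \<notin> A" | "z \<notin> \<Omega>" "z \<notin> A" by (auto simp: A_def)
    then show ?case
    proof cases
      case 1
      then show ?thesis using elim less_c[of z]
        by (auto simp: g_def A_def intro!: mult_nonpos_nonpos)
    next
      case 2
      then show ?thesis using elim gr_c[of z]
        by (auto simp: g_def A_def)
    qed (use elim in \<open>simp add: g_def\<close>)
  qed
  show "integral\<^sup>L \<rho>0 \<phi> \<le> integral\<^sup>L \<rho> \<phi>"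
    using integral_nonneg_AE[OF g0] I_g by simp
  assume "integral\<^sup>L \<rho> \<phi> \<le> integral\<^sup>L \<rho>0 \<phi>"
  with integral_nonneg_AE[OF g0] I_g have "integral\<^sup>L ?L g = 0" by simp
  then have "AE z in ?L. g z = 0"
    using integral_nonneg_eq_0_iff_AE[OF int_g g0] by simp
  with sphere have "AE z in ?L. f z = indicator A z"
  proof eventually_elim
    case (elim z)
    then show ?case using less_c[of z] gr_c[of z]
      by (cases "dist_Rd d z x < r") (auto simp: g_def)
  qed
  then have "AE z in ?L. ennreal (f z) = ennreal (indicator A z)"
    by eventually_elim simp
  then show "\<rho> = \<rho>0"
    unfolding \<rho>_eq \<rho>0_eq by (intro density_cong) auto
qed

text \<open>The outer power undoes \<open>1 / p\<close>. If the nonnegative integral is infinite,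
  \<open>enn2real\<close> and the Bochner integral both give 0.\<close>

lemma wasserstein_dirac_powr:
  assumes "prob_space \<rho>" and [measurable_cong, simp]: "sets \<rho> = sets (borel_Rd d)"
    and x: "x \<in> space (borel_Rd d)" and p: "0 < p"
  shows "wasserstein d p \<rho> (return (borel_Rd d) x) powr p = (\<integral>z. dist_Rd d z x powr p \<partial>\<rho>)"
proof -
  have "(\<integral>z. dist_Rd d z x powr p \<partial>\<rho>) = enn2real (\<integral>\<^sup>+ z. ennreal (dist_Rd d z x powr p) \<partial>\<rho>)"
    by (intro integral_eq_nn_integral) auto
  then show ?thesis
    using assms by (simp add: wasserstein_def transport_cost_dirac powr_powr)
qed

text \<open>The projection is defined by \<open>THE\<close>, so both halves of
  \<open>cost_dirac_ball_minimal\<close> enter: the first makes the ball a minimizer, the second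
  makes it the only one.\<close>

lemma wasserstein_proj_dirac:
  assumes d: "d > 0" and \<Omega> [measurable]: "\<Omega> \<in> sets (borel_Rd d)"
    and bnd: "\<And>z. z \<in> \<Omega> \<Longrightarrow> norm_Rd d z \<le> D" and x: "x \<in> space (borel_Rd d)"
    and p: "0 < p" and r: "0 \<le> r"
    and vol: "emeasure (lborel_Rd d) {z\<in>\<Omega>. dist_Rd d z x \<le> r} = 1"
  shows "wasserstein_proj d p \<Omega> (return (borel_Rd d) x)
      = density (lborel_Rd d) (indicator {z\<in>\<Omega>. dist_Rd d z x \<le> r})" (is "_ = ?\<rho>0")
proof -
  let ?F = "\<lambda>\<rho>. wasserstein d p \<rho> (return (borel_Rd d) x) powr p"
  have F: "?F \<rho> = (\<integral>z. dist_Rd d z x powr p \<partial>\<rho>)" if "\<rho> \<in> bounded_density_measures d p \<Omega>" for \<rho>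
    using that x p
    by (intro wasserstein_dirac_powr) (auto simp: bounded_density_measures_def prob_measures_def)
  have sub: "\<Omega> \<subseteq> {..<d} \<rightarrow>\<^sub>E UNIV" using sets.sets_into_space[OF \<Omega>] by simp
  have "{z\<in>\<Omega>. dist_Rd d z x \<le> r} = {z \<in> space (borel_Rd d). z \<in> \<Omega> \<and> dist_Rd d z x \<le> r}"
    using sub by auto
  also have "\<dots> \<in> sets (borel_Rd d)" by measurable
  finally have mem: "?\<rho>0 \<in> bounded_density_measures d p \<Omega>"
    using vol bnd p by (intro uniform_bounded_density_measures) auto
  note min = cost_dirac_ball_minimal[OF d \<Omega> bnd x p r vol]
  show ?thesis
    unfolding wasserstein_proj_def
  proof (rule the_equality)
    show "is_arg_min ?F (\<lambda>\<rho>. \<rho> \<in> bounded_density_measures d p \<Omega>) ?\<rho>0"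
      using mem min(1) by (auto simp: is_arg_min_linorder F)
    show "\<rho> = ?\<rho>0" if "is_arg_min ?F (\<lambda>\<rho>. \<rho> \<in> bounded_density_measures d p \<Omega>) \<rho>" for \<rho>
      using that mem min(2)[of \<rho>] by (auto simp: is_arg_min_linorder F)
  qed
qed

section \<open>The wedge\<close>

text \<open>The slope \<open>1 / (3200 * d\<^sup>2)\<close> gives the slice \<open>0 \<le> z 0 \<le> 80 * d\<close> volume 1.\<close>

definition wedge :: "nat \<Rightarrow> (nat \<Rightarrow> real) set" where
  "wedge d = {z \<in> {..<d} \<rightarrow>\<^sub>E UNIV. 0 \<le> z 0 \<and> z 0 \<le> 100 * real d \<and> 0 \<le> z 1 \<and>
     3200 * (real d)\<^sup>2 * z 1 \<le> z 0 \<and> (\<forall>i\<in>{2..<d}. 0 \<le> z i \<and> z i \<le> 1)}"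

lemma closed_wedge:
  assumes d: "1 < d"
  shows "closed_Rd d (wedge d)"
proof -
  define T where "T = product_topology (\<lambda>_::nat. euclideanreal) {..<d}"
  have T: "topspace T = {..<d} \<rightarrow>\<^sub>E UNIV" by (simp add: T_def)
  have cont: "continuous_map T euclideanreal (\<lambda>z. z i)" if "i < d" for i
    unfolding T_def using that continuous_map_product_projection[of i "{..<d}" "\<lambda>_. euclideanreal"] by simp
  have cont': "continuous_map T euclideanreal (\<lambda>z. z 0 - 3200 * (real d)\<^sup>2 * z 1)"
    using d by (intro continuous_map_diff continuous_map_real_mult_left cont) auto
  \<comment> \<open>Giving the first two coordinates the trivial condition \<open>UNIV\<close> lets
    the intersection run over \<open>{..<d}\<close>. The index set \<open>{2..<d}\<close> is empty
    for \<open>d = 2\<close>, and \<open>closedin_INT\<close> requires a nonempty family.\<close>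
  define C :: "nat \<Rightarrow> real set" where "C i = (if i < 2 then UNIV else {0..1})" for i
  have box: "(\<forall>i\<in>{..<d}. z i \<in> C i) \<longleftrightarrow>
      (\<forall>i\<in>{2..<d}. 0 \<le> z i \<and> z i \<le> 1)" for z :: "nat \<Rightarrow> real"
  proof (intro iffI ballI)
    fix i assume *: "\<forall>i\<in>{..<d}. z i \<in> C i" and i: "i \<in> {2..<d}"
    from i have "i \<in> {..<d}" "\<not> i < 2" by auto
    with * have "z i \<in> {0..1}" by (metis C_def)
    then show "0 \<le> z i \<and> z i \<le> 1" by simp
  qed (auto simp: C_def)
  have "wedge d = ({z\<in>topspace T. z 0 \<in> {0..100 * real d}} \<inter> {z\<in>topspace T. z 1 \<in> {0..}}) \<inter>
      ({z\<in>topspace T. z 0 - 3200 * (real d)\<^sup>2 * z 1 \<in> {0..}} \<inter>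
      (\<Inter>i\<in>{..<d}. {z\<in>topspace T. z i \<in> C i}))"
    using d unfolding wedge_def T box[symmetric] by auto
  also have "closedin T \<dots>"
    using d by (intro closedin_Int closedin_INT closedin_continuous_map_preimage[OF cont]
      closedin_continuous_map_preimage[OF cont']) (auto simp: lessThan_empty_iff C_def)
  finally show ?thesis by (simp add: closed_Rd_def T_def)
qed

lemma convex_wedge:
  assumes d: "1 < d"
  shows "convex_Rd d (wedge d)"
  unfolding convex_Rd_def
proof (intro conjI ballI allI impI)
  show "wedge d \<subseteq> {..<d} \<rightarrow>\<^sub>E UNIV" by (auto simp: wedge_def)
next
  fix x y u v assume x: "x \<in> wedge d" and y: "y \<in> wedge d" and u: "0 \<le> u" and v: "0 \<le> v" and uv: "u + v = (1::real)"
  have comb: "u * a + v * b \<le> c" if "a \<le> c" "b \<le> c" for a b c :: real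
    using convex_bound_le[OF that u v uv] .
  show "(\<lambda>i\<in>{..<d}. u * x i + v * y i) \<in> wedge d"
    unfolding wedge_def
  proof (intro CollectI conjI ballI)
    have "u * (3200 * (real d)\<^sup>2 * x 1) + v * (3200 * (real d)\<^sup>2 * y 1) \<le> u * x 0 + v * y 0"
      using x y u v by (intro add_mono mult_left_mono) (auto simp: wedge_def)
    then show "3200 * (real d)\<^sup>2 * (\<lambda>i\<in>{..<d}. u * x i + v * y i) 1 \<le> (\<lambda>i\<in>{..<d}. u * x i + v * y i) 0"
      using d by (simp add: algebra_simps)
  qed (use x y u v d in \<open>auto simp: wedge_def intro: comb\<close>)
qed

lemma sets_wedge [measurable]: "wedge d \<in> sets (borel_Rd d)"
proof -
  have "wedge d = {z \<in> space (borel_Rd d). 0 \<le> z 0 \<and> z 0 \<le> 100 * real d \<and> 0 \<le> z 1 \<and>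
     3200 * (real d)\<^sup>2 * z 1 \<le> z 0 \<and> (\<forall>i\<in>{2..<d}. 0 \<le> z i \<and> z i \<le> 1)}"
    by (simp add: wedge_def)
  also have "\<dots> \<in> sets (borel_Rd d)"
    by (intro sets.sets_Collect_conj sets.sets_Collect_finite_All borel_measurable_le
      borel_measurable_times borel_measurable_const measurable_component_Rd finite_atLeastLessThan)
  finally show ?thesis .
qed

lemma wedge_subset: "wedge d \<subseteq> space (borel_Rd d)"
  by (auto simp: wedge_def)

lemma sets_wedge_slice: "{z\<in>wedge d. s \<le> z 0 \<and> z 0 \<le> t} \<in> sets (borel_Rd d)"
proof -
  have "{z\<in>wedge d. s \<le> z 0 \<and> z 0 \<le> t} = {z\<in>space (borel_Rd d). z \<in> wedge d \<and> s \<le> z 0 \<and> z 0 \<le> t}"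
    using wedge_subset by auto
  also have "\<dots> \<in> sets (borel_Rd d)" by measurable
  finally show ?thesis .
qed

text \<open>It would be tried on products over index sets other than \<open>{..<d}\<close> as well.\<close>

declare measurable_component_Rd [measurable del]

text \<open>Fubini with \<open>c = 3200 * d^2\<close>: coordinate 1 contributes the length
  \<open>z 0 / c\<close>, coordinate 0 then contributes the integral of \<open>y / c\<close> over
  \<open>[s, t]\<close>, and the remaining unit cube contributes 1.\<close>

lemma emeasure_wedge_slice:
  assumes d: "1 < d" and s: "0 \<le> s" "s \<le> t" and t: "t \<le> 100 * real d"
  shows "emeasure (lborel_Rd d) {z\<in>wedge d. s \<le> z 0 \<and> z 0 \<le> t} = ennreal ((t\<^sup>2 - s\<^sup>2) / (6400 * (real d)\<^sup>2))"
proof -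
  interpret product_sigma_finite "\<lambda>_::nat. lborel :: real measure" ..
  define S where "S = {z\<in>wedge d. s \<le> z 0 \<and> z 0 \<le> t}"
  have S: "S \<in> sets (lborel_Rd d)" unfolding S_def using sets_wedge_slice by simp
  define c where "c = 3200 * (real d)\<^sup>2"
  have c: "c > 0" using d by (simp add: c_def)
  let ?I = "\<lambda>a b x. indicator {a..b::real} x :: ennreal"
  let ?P = "\<lambda>z. \<Prod>i\<in>{2..<d}. ?I 0 1 (z i)"
  let ?J = "insert 0 {2..<d}"
  let ?M = "\<lambda>_::nat. lborel :: real measure"
  \<comment> \<open>Coordinate 1 is split off first because its range depends on coordinate
    0.\<close>
  have D: "{..<d} = insert 1 ?J" using d by auto
  have P: "?P z = (if \<forall>i\<in>{2..<d}. 0 \<le> z i \<and> z i \<le> 1 then 1 else 0)" for z :: "nat \<Rightarrow> real"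
    by (auto simp: indicator_def intro!: prod.neutral)
  have "emeasure (lborel_Rd d) S = (\<integral>\<^sup>+ z. indicator S z \<partial>lborel_Rd d)"
    using S by simp
  also have "\<dots> = (\<integral>\<^sup>+ z. (\<integral>\<^sup>+ y. indicator S (z(1 := y)) \<partial>lborel) \<partial>PiM ?J ?M)"
    using S unfolding lborel_Rd_def D by (subst product_nn_integral_insert) auto
  also have "\<dots> = (\<integral>\<^sup>+ z. ?I s t (z 0) * ennreal (z 0 / c) * ?P z \<partial>PiM ?J ?M)"
  proof (intro nn_integral_cong)
    fix z assume "z \<in> space (PiM ?J ?M)"
    then have "z \<in> ?J \<rightarrow>\<^sub>E UNIV" by (simp add: space_PiM)
    then have z: "z(1 := y) \<in> {..<d} \<rightarrow>\<^sub>E UNIV" for y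
      unfolding D by (auto simp: PiE_def extensional_def)
    have "indicator S (z(1 := y)) = ?I s t (z 0) * ?P z * ?I 0 (z 0 / c) y" for y
    proof -
      have "z(1 := y) \<in> S \<longleftrightarrow> s \<le> z 0 \<and> z 0 \<le> t \<and> 0 \<le> y \<and> y \<le> z 0 / c \<and>
          (\<forall>i\<in>{2..<d}. 0 \<le> z i \<and> z i \<le> 1)"
        using z[of y] s t c unfolding S_def wedge_def c_def[symmetric] by (auto simp: field_simps)
      then show ?thesis unfolding P by (auto simp: indicator_def)
    qed
    then have "(\<integral>\<^sup>+ y. indicator S (z(1 := y)) \<partial>lborel)
        = ?I s t (z 0) * ?P z * (\<integral>\<^sup>+ y. ?I 0 (z 0 / c) y \<partial>lborel)"
      by (simp add: nn_integral_cmult)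
    \<comment> \<open>For negative \<open>z 0\<close> the interval is empty, and
      \<open>ennreal\<close> sends the negative quotient to 0 as well.\<close>
    also have "(\<integral>\<^sup>+ y. ?I 0 (z 0 / c) y \<partial>lborel) = ennreal (z 0 / c)"
      by (auto simp: emeasure_lborel_Icc_eq ennreal_neg)
    finally show "(\<integral>\<^sup>+ y. indicator S (z(1 := y)) \<partial>lborel) = ?I s t (z 0) * ennreal (z 0 / c) * ?P z"
      by (simp only: mult_ac)
  qed
  also have "\<dots> = (\<integral>\<^sup>+ z. (\<integral>\<^sup>+ y. ?I s t y * ennreal (y / c) * ?P z \<partial>lborel) \<partial>PiM {2..<d} ?M)"
  proof (subst product_nn_integral_insert)
    have [measurable]: "(\<lambda>z. z i) \<in> borel_measurable (PiM ?J ?M)" if "i \<in> ?J" for i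
      using measurable_component_singleton[OF that, of ?M] by simp
    show "(\<lambda>z. ?I s t (z 0) * ennreal (z 0 / c) * ?P z) \<in> borel_measurable (PiM ?J ?M)"
      by measurable
    have "?P (z(0 := y)) = ?P z" for z :: "nat \<Rightarrow> real" and y
      by (intro prod.cong) auto
    then show "(\<integral>\<^sup>+ z. (\<integral>\<^sup>+ y. ?I s t ((z(0 := y)) 0) * ennreal ((z(0 := y)) 0 / c) * ?P (z(0 := y)) \<partial>lborel) \<partial>PiM {2..<d} ?M)
      = (\<integral>\<^sup>+ z. (\<integral>\<^sup>+ y. ?I s t y * ennreal (y / c) * ?P z \<partial>lborel) \<partial>PiM {2..<d} ?M)"
      by simp
  qed auto
  also have "\<dots> = (\<integral>\<^sup>+ z. (\<integral>\<^sup>+ y. ennreal (y / c) * ?I s t y \<partial>lborel) * ?P z \<partial>PiM {2..<d} ?M)"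
    by (intro nn_integral_cong, subst nn_integral_multc[symmetric]) (auto simp: mult_ac)
  also have "\<dots> = (\<integral>\<^sup>+ y. ennreal (y / c) * ?I s t y \<partial>lborel) * (\<integral>\<^sup>+ z. ?P z \<partial>PiM {2..<d} ?M)"
    by (rule nn_integral_cmult) measurable
  also have "(\<integral>\<^sup>+ z. ?P z \<partial>PiM {2..<d} ?M) = 1"
    by (subst product_nn_integral_prod) auto
  also have "(\<integral>\<^sup>+ y. ennreal (y / c) * ?I s t y \<partial>lborel) = ennreal (t\<^sup>2 / (2 * c) - s\<^sup>2 / (2 * c))"
    using s c by (intro nn_integral_FTC_Icc) (auto intro!: derivative_eq_intros)
  finally show ?thesis
    by (simp add: S_def c_def diff_divide_distrib)
qed

section \<open>Balls centred on the axis, compared with slices\<close>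

definition axis_pt :: "nat \<Rightarrow> real \<Rightarrow> nat \<Rightarrow> real" where
  "axis_pt d s = (\<lambda>i\<in>{..<d}. if i = 0 then s else 0)"

lemma axis_pt_in_wedge: "1 < d \<Longrightarrow> 0 \<le> s \<Longrightarrow> s \<le> 100 * real d \<Longrightarrow> axis_pt d s \<in> wedge d"
  by (auto simp: axis_pt_def wedge_def)

lemma dist_axis_pt:
  assumes d: "0 < d"
  shows "dist_Rd d (axis_pt d s) (axis_pt d t) = \<bar>s - t\<bar>"
proof -
  from d have D: "{..<d} = insert 0 {1..<d}" by auto
  have "(dist_Rd d (axis_pt d s) (axis_pt d t))\<^sup>2 = \<bar>s - t\<bar>\<^sup>2"
    unfolding dist_Rd_power2 D by (subst sum.insert) (use d in \<open>auto simp: axis_pt_def\<close>)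
  then show ?thesis
    by (rule power2_eq_imp_eq) auto
qed

text \<open>Coordinate 1 is at most \<open>100 * d / (3200 * d^2)\<close>, which is below 1. The
  wedge thus has transverse extent at most 1 in each direction, against a length proportional to
  \<open>d\<close>.\<close>

lemma wedge_coord_le_1:
  assumes d: "1 < d" and z: "z \<in> wedge d" and i: "i \<in> {1..<d}"
  shows "0 \<le> z i" "z i \<le> 1"
proof -
  have "z 1 \<le> 1"
  proof -
    have "3200 * (real d)\<^sup>2 * z 1 \<le> z 0" "z 0 \<le> 100 * real d"
      using z by (auto simp: wedge_def)
    then have "3200 * (real d)\<^sup>2 * z 1 \<le> 100 * real d" by (rule order_trans)
    also have "\<dots> \<le> 3200 * (real d)\<^sup>2 * 1"
      using d by (simp add: power2_eq_square)
    finally show ?thesis by (rule mult_left_le_imp_le) (use d in simp)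
  qed
  then show "0 \<le> z i" "z i \<le> 1"
    using z i by (cases "i = 1"; auto simp: wedge_def)+
qed

lemma norm_wedge_le:
  assumes d: "1 < d" and z: "z \<in> wedge d"
  shows "norm_Rd d z \<le> real d * (100 * real d)"
proof -
  have "norm_Rd d z \<le> (\<Sum>i<d. \<bar>z i\<bar>)" unfolding norm_Rd_def by (rule L2_set_le_sum_abs)
  also have "\<dots> \<le> (\<Sum>i<d. 100 * real d)"
  proof (intro sum_mono)
    fix i assume "i \<in> {..<d}"
    then show "\<bar>z i\<bar> \<le> 100 * real d"
      using wedge_coord_le_1[OF d z, of i] z d by (cases "i = 0") (auto simp: wedge_def)
  qed
  finally show ?thesis by simp
qed

text \<open>Each of the \<open>d - 1\<close> transverse coordinates adds at most 1 to the square. On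
  the length scale \<open>d\<close> of the wedge, where squares are of order \<open>d^2\<close>,
  this is a small error.\<close>

lemma dist_wedge_axis_pt_le:
  assumes d: "1 < d" and z: "z \<in> wedge d"
  shows "(dist_Rd d z (axis_pt d s))\<^sup>2 \<le> (z 0 - s)\<^sup>2 + real d"
proof -
  have D: "{..<d} = insert 0 {1..<d}" using d by auto
  have "(dist_Rd d z (axis_pt d s))\<^sup>2 = (z 0 - s)\<^sup>2 + (\<Sum>i\<in>{1..<d}. (z i)\<^sup>2)"
    unfolding dist_Rd_power2 D by (subst sum.insert) (use d in \<open>auto simp: axis_pt_def\<close>)
  also have "(\<Sum>i\<in>{1..<d}. (z i)\<^sup>2) \<le> (\<Sum>i\<in>{1..<d}. 1)"
    using wedge_coord_le_1[OF d z] by (intro sum_mono) (auto intro!: power_le_one)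
  also have "\<dots> \<le> real d" by simp
  finally show ?thesis by simp
qed

text \<open>Together with \<open>ball_subset_slice\<close> this traps a ball between slices, whose
  volumes are explicit.\<close>

lemma slice_subset_ball:
  assumes d: "1 < d" and "0 \<le> r" and w: "w\<^sup>2 + real d \<le> r\<^sup>2" and "s - w \<le> a" "b \<le> s + w"
  shows "{z\<in>wedge d. a \<le> z 0 \<and> z 0 \<le> b} \<subseteq> {z\<in>wedge d. dist_Rd d z (axis_pt d s) \<le> r}"
proof safe
  fix z assume z: "z \<in> wedge d" "a \<le> z 0" "z 0 \<le> b"
  then have "\<bar>z 0 - s\<bar> \<le> w" using assms by auto
  then have "(z 0 - s)\<^sup>2 \<le> w\<^sup>2" by (rule abs_le_square_iff[THEN iffD1, OF order_trans[OF _ abs_ge_self]])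
  then have "(dist_Rd d z (axis_pt d s))\<^sup>2 \<le> r\<^sup>2"
    using dist_wedge_axis_pt_le[OF d z(1), of s] w by linarith
  then show "dist_Rd d z (axis_pt d s) \<le> r" using \<open>0 \<le> r\<close> by (rule power2_le_imp_le)
qed

lemma ball_subset_slice:
  assumes d: "1 < d"
  shows "{z\<in>wedge d. dist_Rd d z (axis_pt d s) \<le> r} \<subseteq> {z\<in>wedge d. s - r \<le> z 0 \<and> z 0 \<le> s + r}"
proof safe
  fix z assume "z \<in> wedge d" "dist_Rd d z (axis_pt d s) \<le> r"
  then have "\<bar>z 0 - s\<bar> \<le> r" using abs_coord_le_dist_Rd[of 0 d z "axis_pt d s"] d by (simp add: axis_pt_def)
  then show "s - r \<le> z 0" "z 0 \<le> s + r" by auto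
qed

section \<open>The two projections and their distance\<close>

text \<open>
  Along the axis in units of \<open>d\<close>: the slice \<open>[0, 80]\<close> has volume 1, so the radius around 40 is at
  least 40 and the ball contains the slice \<open>[4, 8]\<close>. The slice \<open>[40, 90]\<close> has volume greater than 1
  and lies in the ball of radius 28 around 65, so the second projection lives beyond
  \<open>65 - 28 = 37\<close>, at distance \<open>37 - 8 = 29 > 65 - 40\<close> from the slice \<open>[4, 8]\<close>.
\<close>

lemma wasserstein_projections_gt:
  assumes d: "1 < d" and p: "p \<ge> 40 * real d"
  defines "\<mu> \<equiv> return (borel_Rd d) (axis_pt d (40 * real d))"
  defines "\<nu> \<equiv> return (borel_Rd d) (axis_pt d (65 * real d))"
  shows "wasserstein d p \<mu> \<nu> <
    wasserstein d p (wasserstein_proj d p (wedge d) \<mu>) (wasserstein_proj d p (wedge d) \<nu>)"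
proof -
  let ?L = "lborel_Rd d" and ?D = "real d * (100 * real d)"
  define x y where "x = axis_pt d (40 * real d)" and "y = axis_pt d (65 * real d)"
  have d1: "1 \<le> real d" and d2: "real d \<le> (real d)\<^sup>2"
    using d by (auto simp: power2_eq_square)
  have "x \<in> wedge d" "y \<in> wedge d" unfolding x_def y_def using d by (auto intro!: axis_pt_in_wedge)
  then have xy: "x \<in> space (borel_Rd d)" "y \<in> space (borel_Rd d)" using wedge_subset by blast+
  \<comment> \<open>Since \<open>d\<close> is at least 2, the constant 40 gives the exponent 80 used
    in \<open>ratio\<close>.\<close>
  have p80: "80 \<le> p" using p d1 d by linarith
  have "wedge d = {z\<in>wedge d. 0 \<le> z 0 \<and> z 0 \<le> 100 * real d}" by (auto simp: wedge_def)
  then have fin: "emeasure ?L (wedge d) < \<infinity>"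
    using emeasure_wedge_slice[OF d, of 0 "100 * real d"] d by simp
  define S where "S a b = {z\<in>wedge d. a * real d \<le> z 0 \<and> z 0 \<le> b * real d}" for a b
  have S [simp]: "S a b \<in> sets (borel_Rd d)" for a b
    unfolding S_def by (rule sets_wedge_slice)
  have vol: "emeasure ?L (S a b) = ennreal ((b\<^sup>2 - a\<^sup>2) / 6400)" if "0 \<le> a" "a \<le> b" "b \<le> 100" for a b
    unfolding S_def using that d
    by (subst emeasure_wedge_slice) (auto simp: power_mult_distrib field_simps)
  define B where "B s r = {z\<in>wedge d. dist_Rd d z (axis_pt d (s * real d)) \<le> r}" for s r
  have B: "B s r \<in> sets (borel_Rd d)" for s r
  proof -
    have "B s r = {z\<in>space (borel_Rd d). z \<in> wedge d \<and> dist_Rd d z (axis_pt d (s * real d)) \<le> r}"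
      using wedge_subset by (auto simp: B_def)
    also have "\<dots> \<in> sets (borel_Rd d)" by measurable
    finally show ?thesis .
  qed
  have BS: "B s (r * real d) \<subseteq> S (s - r) (s + r)" for s r
    unfolding B_def S_def using ball_subset_slice[OF d, of "s * real d" "r * real d"]
    by (auto simp: algebra_simps)
  \<comment> \<open>In units of \<open>d\<close>, the transverse error \<open>d\<close> in the
    squared distance is at most 1, because \<open>d \<le> d^2\<close>.\<close>
  have SB: "S a b \<subseteq> B s (r * real d)"
    if "s - w \<le> a" "b \<le> s + w" "0 \<le> r" "w\<^sup>2 + 1 \<le> r\<^sup>2" for a b s r w
    unfolding B_def S_def
  proof (rule slice_subset_ball[OF d])
    have "(w * real d)\<^sup>2 + real d \<le> (w\<^sup>2 + 1) * (real d)\<^sup>2"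
      using d2 by (simp add: power_mult_distrib algebra_simps)
    also have "\<dots> \<le> (r * real d)\<^sup>2"
      using that by (simp add: power_mult_distrib mult_right_mono)
    finally show "(w * real d)\<^sup>2 + real d \<le> (r * real d)\<^sup>2" .
    show "s * real d - w * real d \<le> a * real d" "b * real d \<le> s * real d + w * real d"
      using that d1 by (simp_all add: left_diff_distrib[symmetric] distrib_right[symmetric])
  qed (use that in auto)

  obtain r1 where r1: "40 * real d \<le> r1" and volx: "emeasure ?L (B 40 r1) = 1"
  proof -
    \<comment> \<open>The ball of radius 40 lies in the slice \<open>[0, 80]\<close> of volume 1,
      and the ball of radius 41 contains that slice since
      \<open>40^2 + 1 \<le> 41^2\<close>.\<close>
    have "\<exists>r. 40 * real d \<le> r \<and> r \<le> 41 * real d \<and> emeasure ?L (B 40 r) = ennreal 1"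
      unfolding B_def
    proof (rule ex_radius_measure_eq)
      show "emeasure ?L {z \<in> wedge d. dist_Rd d z (axis_pt d (40 * real d)) \<le> 40 * real d} \<le> ennreal 1"
        using emeasure_mono[of _ _ ?L, OF BS[of 40 40]] vol[of 0 80] by (simp add: B_def)
      show "ennreal 1 \<le> emeasure ?L {z \<in> wedge d. dist_Rd d z (axis_pt d (40 * real d)) \<le> 41 * real d}"
        using emeasure_mono[of _ _ ?L, OF SB[of 40 40 0 80 41]] vol[of 0 80] B[of 40 "41 * real d"]
        by (simp add: B_def)
    qed (use d fin sets_wedge in auto)
    then show ?thesis using that by auto
  qed
  obtain r2 where r2: "0 \<le> r2" "r2 \<le> 28 * real d" and voly: "emeasure ?L (B 65 r2) = 1"
  proof -
    \<comment> \<open>The slice \<open>[40, 90]\<close> has volume \<open>6500 / 6400\<close> and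
      half-width 25 around 65; the ball of radius 28 contains it because
      \<open>25^2 + 1 \<le> 28^2\<close>.\<close>
    have "\<exists>r. 0 \<le> r \<and> r \<le> 28 * real d \<and> emeasure ?L (B 65 r) = ennreal 1"
      unfolding B_def
    proof (rule ex_radius_measure_eq)
      show "emeasure ?L {z \<in> wedge d. dist_Rd d z (axis_pt d (65 * real d)) \<le> 0} \<le> ennreal 1"
        using emeasure_mono[of _ _ ?L, OF BS[of 65 0]] vol[of 65 65] by (simp add: B_def)
      have "(1::ennreal) \<le> emeasure ?L (S 40 90)"
        using vol[of 40 90] by simp
      also have "\<dots> \<le> emeasure ?L (B 65 (28 * real d))"
        using SB[of 65 25 40 90 28] B[of 65 "28 * real d"] by (intro emeasure_mono) auto
      finally show "ennreal 1 \<le> emeasure ?L {z \<in> wedge d. dist_Rd d z (axis_pt d (65 * real d)) \<le> 28 * real d}"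
        by (simp add: B_def)
    qed (use d fin sets_wedge in auto)
    then show ?thesis using that by auto
  qed
  define \<rho>1 where "\<rho>1 = density ?L (indicator (B 40 r1))"
  define \<rho>2 where "\<rho>2 = density ?L (indicator (B 65 r2))"
  have proj1: "wasserstein_proj d p (wedge d) \<mu> = \<rho>1"
    unfolding \<mu>_def \<rho>1_def B_def
    by (rule wasserstein_proj_dirac[where D = ?D])
      (use d p80 r1 xy volx norm_wedge_le sets_wedge in \<open>auto simp: B_def x_def\<close>)
  have proj2: "wasserstein_proj d p (wedge d) \<nu> = \<rho>2"
    unfolding \<nu>_def \<rho>2_def B_def
    by (rule wasserstein_proj_dirac[where D = ?D])
      (use d p80 r2 xy voly norm_wedge_le sets_wedge in \<open>auto simp: B_def y_def\<close>)
  have "\<rho>1 \<in> bounded_density_measures d p (wedge d)" "\<rho>2 \<in> bounded_density_measures d p (wedge d)"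
    unfolding \<rho>1_def \<rho>2_def using d p80 volx voly B norm_wedge_le
    by (auto intro!: uniform_bounded_density_measures[where D = ?D] simp: B_def)
  then have prob: "prob_space \<rho>1" "prob_space \<rho>2" and sets: "sets \<rho>1 = sets (borel_Rd d)" "sets \<rho>2 = sets (borel_Rd d)"
    and supp: "AE z in \<rho>1. z \<in> wedge d" "AE z in \<rho>2. z \<in> wedge d"
    by (auto simp: bounded_density_measures_def prob_measures_def)

  define T where "T = transport_cost d p \<rho>1 \<rho>2"
  have T_fin: "T < \<infinity>"
    unfolding T_def
  proof (rule transport_cost_finite[OF prob sets])
    show "AE z in \<rho>1. norm_Rd d z \<le> ?D" "AE z in \<rho>2. norm_Rd d z \<le> ?D"
      using supp norm_wedge_le[OF d] by (auto elim!: eventually_mono)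
  qed (use p80 in simp)
  \<comment> \<open>The slice \<open>[4, 8]\<close> is within 36 of the centre 40 along the axis,
    and \<open>36^2 + 1 \<le> 40^2\<close>. Its volume is \<open>(64 - 16) / 6400\<close>.\<close>
  have mass: "emeasure \<rho>1 (S 4 8) = ennreal (3 / 400)"
  proof -
    have "S 4 8 \<subseteq> B 40 (40 * real d)" by (rule SB[of 40 36]) auto
    also have "\<dots> \<subseteq> B 40 r1" using r1 by (auto simp: B_def)
    finally have "B 40 r1 \<inter> S 4 8 = S 4 8" by auto
    then show ?thesis
      unfolding \<rho>1_def using vol[of 4 8] B by (subst emeasure_restricted) auto
  qed
  have "ennreal ((29 * real d) powr p) * emeasure \<rho>1 (S 4 8) \<le> T"
    unfolding T_def
  proof (rule transport_cost_ge_gap[OF sets S B[of 65 r2]])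
    show "AE z in \<rho>2. z \<in> B 65 r2"
      unfolding \<rho>2_def using B by (subst AE_density) (auto split: split_indicator)
    fix u v assume "u \<in> S 4 8" "v \<in> B 65 r2"
    moreover have "B 65 r2 \<subseteq> S 37 93"
      using BS[of 65 28] r2 by (auto simp: B_def)
    ultimately have "29 * real d \<le> \<bar>u 0 - v 0\<bar>" by (auto simp: S_def)
    also have "\<dots> \<le> dist_Rd d u v" using d by (intro abs_coord_le_dist_Rd) auto
    finally show "29 * real d \<le> dist_Rd d u v" .
  qed (use p80 in auto)
  then have "ennreal ((29 * real d) powr p * (3 / 400)) \<le> ennreal (enn2real T)"
    using T_fin by (simp only: mass) (simp flip: ennreal_mult add: ennreal_enn2real)
  then have lower: "(29 * real d) powr p * (3 / 400) \<le> enn2real T"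
    by (subst (asm) ennreal_le_iff) auto
  \<comment> \<open>The gain \<open>29 / 25\<close> per unit of exponent has to outweigh the mass
    fraction \<open>3 / 400\<close>. Its fifth power exceeds 2, so exponent 80 yields at least 16
    doublings.\<close>
  have ratio: "400 / 3 < (29 / 25 :: real) powr p"
  proof -
    have "400 / 3 < (2::real) ^ 16" by simp
    also have "\<dots> \<le> ((29 / 25) ^ 5) ^ 16" by (intro power_mono) (simp_all add: power_divide)
    also have "\<dots> = (29 / 25) ^ (5 * 16)" by (rule power_mult[symmetric])
    also have "\<dots> = (29 / 25) powr real (5 * 16)" by (rule powr_realpow[symmetric]) simp
    also have "\<dots> \<le> (29 / 25) powr p" using p80 by (intro powr_mono) auto
    finally show ?thesis .
  qed
  have "(29 * real d) powr p = (29 / 25) powr p * (25 * real d) powr p"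
    using d1 by (simp flip: powr_mult)
  then have "(25 * real d) powr p < (29 * real d) powr p * (3 / 400)"
    using ratio d by simp
  with lower have "(25 * real d) powr p < enn2real T" by linarith
  then have "((25 * real d) powr p) powr (1 / p) < enn2real T powr (1 / p)"
    using p80 by (intro powr_less_mono2) auto
  then have "25 * real d < wasserstein d p \<rho>1 \<rho>2"
    using p80 d by (simp add: wasserstein_def T_def powr_powr)
  moreover have "wasserstein d p \<mu> \<nu> = 25 * real d"
  proof -
    have "transport_cost d p \<mu> \<nu> = ennreal ((25 * real d) powr p)"
      unfolding \<mu>_def \<nu>_def x_def[symmetric] y_def[symmetric] using xy d
      by (subst transport_cost_dirac)
        (auto simp: prob_space_return nn_integral_return x_def y_def dist_axis_pt)
    then show ?thesis using p80 d by (simp add: wasserstein_def powr_powr)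
  qed
  ultimately show ?thesis by (simp add: proj1 proj2)
qed

theorem proposition3p7:
  "\<exists>C::real. C \<ge> 1 \<and>
     (\<forall>d::nat. d > 1 \<longrightarrow>
       (\<exists>\<Omega> :: (nat \<Rightarrow> real) set.
          closed_Rd d \<Omega> \<and> convex_Rd d \<Omega> \<and> emeasure (lborel_Rd d) \<Omega> \<ge> 1 \<and>
          (\<forall>p::real. p \<ge> C * real d \<longrightarrow>
            (\<exists>\<mu>\<in>prob_measures d p \<Omega>. \<exists>\<nu>\<in>prob_measures d p \<Omega>.
               wasserstein d p (wasserstein_proj d p \<Omega> \<mu>) (wasserstein_proj d p \<Omega> \<nu>)
                 > wasserstein d p \<mu> \<nu>))))"
proof (intro exI[of _ "40 :: real"] conjI allI impI)
  show "(1::real) \<le> 40" by simp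
next
  fix d :: nat assume d: "1 < d"
  show "\<exists>\<Omega> :: (nat \<Rightarrow> real) set.
          closed_Rd d \<Omega> \<and> convex_Rd d \<Omega> \<and> emeasure (lborel_Rd d) \<Omega> \<ge> 1 \<and>
          (\<forall>p::real. p \<ge> 40 * real d \<longrightarrow>
            (\<exists>\<mu>\<in>prob_measures d p \<Omega>. \<exists>\<nu>\<in>prob_measures d p \<Omega>.
               wasserstein d p (wasserstein_proj d p \<Omega> \<mu>) (wasserstein_proj d p \<Omega> \<nu>)
                 > wasserstein d p \<mu> \<nu>))"
  proof (intro exI[of _ "wedge d"] conjI allI impI)
    show "closed_Rd d (wedge d)" "convex_Rd d (wedge d)"
      using d by (rule closed_wedge, rule convex_wedge)
    have "(1::ennreal) = emeasure (lborel_Rd d) {z\<in>wedge d. 0 \<le> z 0 \<and> z 0 \<le> 80 * real d}"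
      using d by (subst emeasure_wedge_slice) (auto simp: power_mult_distrib)
    also have "\<dots> \<le> emeasure (lborel_Rd d) (wedge d)"
      by (intro emeasure_mono) auto
    finally show "1 \<le> emeasure (lborel_Rd d) (wedge d)" .
    fix p :: real assume p: "40 * real d \<le> p"
    have dirac: "return (borel_Rd d) (axis_pt d (s * real d)) \<in> prob_measures d p (wedge d)"
      if "0 \<le> s" "s \<le> 100" for s
      using d that by (intro dirac_prob_measures axis_pt_in_wedge sets_wedge) auto
    show "\<exists>\<mu>\<in>prob_measures d p (wedge d). \<exists>\<nu>\<in>prob_measures d p (wedge d).
        wasserstein d p (wasserstein_proj d p (wedge d) \<mu>) (wasserstein_proj d p (wedge d) \<nu>)
          > wasserstein d p \<mu> \<nu>"
      by (rule bexI[where x = "return (borel_Rd d) (axis_pt d (40 * real d))"],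
          rule bexI[where x = "return (borel_Rd d) (axis_pt d (65 * real d))"],
          rule wasserstein_projections_gt[OF d p]) (simp_all add: dirac)
  qed
qed

end
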